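(* Let $V$ be a vector space over $\Bbbk$ with ordered basis $\{x_1,\ldots,x_n\}$, let $\mu\in M(n,\Bbbk)$ be multiplicatively antisymmetric, and let $\phi:V\times V\to\Bbbk$ be a $\mu$-symmetric bilinear form relative to this basis. If $\phi\neq 0$, then the skew Clifford algebra $\mathrm{sCl}(V,\mu,\phi)$ is a quotient of a graded skew Clifford algebra that is generated by degree-one elements.
   Context: $\Bbbk$ is a field with $\mathrm{char}(\Bbbk)\neq 2$. A matrix $\mu=(\mu_{ij})\in M(n,\Bbbk)$ is multiplicatively antisymmetric if $\mu_{ij}\mu_{ji}=\mu_{ii}=1$ for all $i,j$. A bilinear form $\phi$ is $\mu$-symmetric (relative to $\{x_1,\ldots,x_n\}$) if $\phi(x_i,x_j)=\mu_{ij}\phi(x_j,x_i)$ for all $i,j$. A matrix $M\in M(n,\Bbbk)$ is $\mu$-symmetric if $M_{ij}=\mu_{ij}M_{ji}$ for all $i,j$. The skew Clifford algebra $\mathrm{sCl}(V,\mu,\phi)$ is the quotient of the tensor algebra $T(V)$ by the two-sided ideal generated by all elements $x_i\otimes x_j+\mu_{ij}\,x_j\otimes x_i-2\phi(x_i,x_j)\cdot 1$, for all $i,j$. Given $\mu$-symmetric matrices $M_1,\ldots,M_n\in M(n,\Bbbk)$, a graded skew Clifford algebra associated to $\mu$ and $M_1,\ldots,M_n$ is a graded $\Bbbk$-algebra on degree-one generators $x_1,\ldots,x_n$ and degree-two generators $y_1,\ldots,y_n$ with defining relations: (a) degree-two relations $x_ix_j+\mu_{ij}x_jx_i=\sum_{k=1}^n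 (M_k)_{ij}y_k$ for all $i,j\in\{1,\ldots,n\}$; and (b) degree-three and degree-four relations (possibly obtainable from the relations in (a)) that guarantee the existence of a normalizing sequence $\{r_1,\ldots,r_n\}$ of homogeneous elements of degree two that span $\Bbbk y_1+\cdots+\Bbbk y_n$. Here a normalizing sequence is a sequence in which $r_1$ is normal and the image of each $r_{i+1}$ is normal modulo the ideal generated by $r_1,\ldots,r_i$. *)

theory Defs
  imports
    "HOL-Analysis.Finite_Cartesian_Product"
    "HOL-Library.Poly_Mapping"
    "HOL-Algebra.QuotRing"
    "HOL-Algebra.Subrings"
    "HOL-Algebra.Module"
begin

section \<open>Algebras over a field\<close>

text \<open>
  A (not necessarily commutative) algebra over a field, given as a type \<open>'k\<close> of class \<open>field\<close>,
  is a record \<open>('k, 'a) module\<close>: a ring record with a scalar multiplication.  The notions \<open>ideal\<close>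
  and \<open>Idl\<close> are two-sided.
\<close>

text \<open>The scalar action on cosets is well defined whenever \<open>I\<close> is a two-sided ideal,
  as \<open>c \<odot> a = (c \<odot> \<one>) \<otimes> a\<close>.\<close>

definition quot_algebra ::
    "('k, 'a, 'm) module_scheme \<Rightarrow> 'a set \<Rightarrow> ('k, 'a set) module"  (infixl "AQuot" 65)
  where "A AQuot I =
    ring.extend (A Quot I) (module.fields (\<lambda>c X. \<Union>a\<in>X. I +>\<^bsub>A\<^esub> (c \<odot>\<^bsub>A\<^esub> a)))"

definition algebra_iso ::
    "('k, 'a, 'm) module_scheme \<Rightarrow> ('k, 'b, 'p) module_scheme \<Rightarrow> ('a \<Rightarrow> 'b) set"
  where "algebra_iso A B =
    {h \<in> ring_iso A B. \<forall>c. \<forall>a\<in>carrier A. h (c \<odot>\<^bsub>A\<^esub> a) = c \<odot>\<^bsub>B\<^esub> h a}"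

definition is_quotient_algebra_of ::
    "('k, 'b, 'p) module_scheme \<Rightarrow> ('k, 'a, 'm) module_scheme \<Rightarrow> bool"
  where "is_quotient_algebra_of B A \<longleftrightarrow> (\<exists>I. ideal I A \<and> algebra_iso (A AQuot I) B \<noteq> {})"

definition linear_span :: "('k, 'a, 'm) module_scheme \<Rightarrow> 'a set \<Rightarrow> 'a set"
  where "linear_span A H =
    \<Inter>{W. additive_subgroup W A \<and> (\<forall>c. \<forall>w\<in>W. c \<odot>\<^bsub>A\<^esub> w \<in> W) \<and> H \<subseteq> W}"

definition generated_subalgebra :: "('k, 'a, 'm) module_scheme \<Rightarrow> 'a set \<Rightarrow> 'a set"
  where "generated_subalgebra A H =
    \<Inter>{W. subring W A \<and> (\<forall>c. \<forall>w\<in>W. c \<odot>\<^bsub>A\<^esub> w \<in> W) \<and> H \<subseteq> W}"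

definition normal_element :: "('a, 'm) ring_scheme \<Rightarrow> 'a \<Rightarrow> bool"
  where "normal_element R r \<longleftrightarrow> r \<in> carrier R \<and> r <#\<^bsub>R\<^esub> carrier R = carrier R #>\<^bsub>R\<^esub> r"

text \<open>For \<open>i = 0\<close> the ideal is zero, so the condition says that the first member is normal in \<open>R\<close>.\<close>

definition normalizing_sequence :: "('a, 'm) ring_scheme \<Rightarrow> 'a list \<Rightarrow> bool"
  where "normalizing_sequence R rs \<longleftrightarrow> set rs \<subseteq> carrier R \<and>
    (\<forall>i < length rs.
      normal_element (R Quot (Idl\<^bsub>R\<^esub> (set (take i rs)))) (Idl\<^bsub>R\<^esub> (set (take i rs)) +>\<^bsub>R\<^esub> (rs ! i)))"


section \<open>Free algebras and tensor algebras\<close>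

text \<open>Words form the free monoid under concatenation, so the convolution product on finitely
  supported functions from words to the field is the product of the free algebra.\<close>

instantiation list :: (type) monoid_add
begin

definition zero_list :: "'a list" where "zero_list = []"

definition plus_list :: "'a list \<Rightarrow> 'a list \<Rightarrow> 'a list" where "plus_list u v = u @ v"

instance
  by standard (simp_all add: zero_list_def plus_list_def)

end

abbreviation monomial :: "'g list \<Rightarrow> 'k::field \<Rightarrow> 'g list \<Rightarrow>\<^sub>0 'k"
  where "monomial w c \<equiv> Poly_Mapping.single w c"

definition free_algebra :: "('k::field, 'g list \<Rightarrow>\<^sub>0 'k) module"
  where "free_algebra =
    \<lparr>carrier = UNIV, mult = (*), one = 1, zero = 0, add = (+),
     smult = (\<lambda>c. Poly_Mapping.map ((*) c))\<rparr>"

text \<open>The tensor algebra of a vector space \<open>V\<close> (the type \<open>'v\<close> with the scalar multiplication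
  \<open>smul\<close>): the free algebra on the set \<open>V\<close>, made linear in the letters.\<close>

definition linearity_relations ::
    "('k::field \<Rightarrow> 'v::ab_group_add \<Rightarrow> 'v) \<Rightarrow> ('v list \<Rightarrow>\<^sub>0 'k) set"
  where "linearity_relations smul =
    {monomial [v + w] 1 - monomial [v] 1 - monomial [w] 1 | v w. True} \<union>
    {monomial [smul c v] 1 - monomial [v] c | c v. True}"

definition tensor_algebra ::
    "('k::field \<Rightarrow> 'v::ab_group_add \<Rightarrow> 'v) \<Rightarrow> ('k, ('v list \<Rightarrow>\<^sub>0 'k) set) module"
  where "tensor_algebra smul =
    free_algebra AQuot (Idl\<^bsub>free_algebra\<^esub> (linearity_relations smul))"

definition tensor_incl ::
    "('k::field \<Rightarrow> 'v::ab_group_add \<Rightarrow> 'v) \<Rightarrow> 'v \<Rightarrow> ('v list \<Rightarrow>\<^sub>0 'k) set"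
  where "tensor_incl smul v =
    Idl\<^bsub>free_algebra\<^esub> (linearity_relations smul) +>\<^bsub>free_algebra\<^esub> monomial [v] 1"


section \<open>Skew Clifford algebras\<close>

definition mult_antisymmetric :: "'k::field^'n^'n \<Rightarrow> bool"
  where "mult_antisymmetric \<mu> \<longleftrightarrow> (\<forall>i j. \<mu> $ i $ j * \<mu> $ j $ i = 1 \<and> \<mu> $ i $ i = 1)"

definition mu_symmetric :: "'k::field^'n^'n \<Rightarrow> 'k^'n^'n \<Rightarrow> bool"
  where "mu_symmetric \<mu> M \<longleftrightarrow> (\<forall>i j. M $ i $ j = \<mu> $ i $ j * M $ j $ i)"

definition mu_symmetric_form ::
    "'k::field^'n^'n \<Rightarrow> ('n \<Rightarrow> 'v) \<Rightarrow> ('v \<Rightarrow> 'v \<Rightarrow> 'k) \<Rightarrow> bool"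
  where "mu_symmetric_form \<mu> x \<phi> \<longleftrightarrow> (\<forall>i j. \<phi> (x i) (x j) = \<mu> $ i $ j * \<phi> (x j) (x i))"

definition bilinear_form ::
    "('k::field \<Rightarrow> 'v::ab_group_add \<Rightarrow> 'v) \<Rightarrow> ('v \<Rightarrow> 'v \<Rightarrow> 'k) \<Rightarrow> bool"
  where "bilinear_form smul \<phi> \<longleftrightarrow>
    (\<forall>v. Vector_Spaces.linear smul (*) (\<phi> v)) \<and>
    (\<forall>w. Vector_Spaces.linear smul (*) (\<lambda>v. \<phi> v w))"

definition ordered_basis ::
    "('k::field \<Rightarrow> 'v::ab_group_add \<Rightarrow> 'v) \<Rightarrow> ('n \<Rightarrow> 'v) \<Rightarrow> bool"
  where "ordered_basis smul x \<longleftrightarrow>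
    inj x \<and> \<not> module.dependent smul (range x) \<and> module.span smul (range x) = UNIV"

definition skew_Clifford_relations ::
    "('k::field \<Rightarrow> 'v::ab_group_add \<Rightarrow> 'v) \<Rightarrow> ('n \<Rightarrow> 'v) \<Rightarrow> 'k^'n^'n \<Rightarrow> ('v \<Rightarrow> 'v \<Rightarrow> 'k) \<Rightarrow>
      ('v list \<Rightarrow>\<^sub>0 'k) set set"
  where "skew_Clifford_relations smul x \<mu> \<phi> =
    (let T = tensor_algebra smul; \<iota> = tensor_incl smul in
      {\<iota> (x i) \<otimes>\<^bsub>T\<^esub> \<iota> (x j) \<oplus>\<^bsub>T\<^esub> (\<mu> $ i $ j) \<odot>\<^bsub>T\<^esub> (\<iota> (x j) \<otimes>\<^bsub>T\<^esub> \<iota> (x i))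
        \<ominus>\<^bsub>T\<^esub> (2 * \<phi> (x i) (x j)) \<odot>\<^bsub>T\<^esub> \<one>\<^bsub>T\<^esub> | i j. True})"

definition skew_Clifford_algebra ::
    "('k::field \<Rightarrow> 'v::ab_group_add \<Rightarrow> 'v) \<Rightarrow> ('n \<Rightarrow> 'v) \<Rightarrow> 'k^'n^'n \<Rightarrow> ('v \<Rightarrow> 'v \<Rightarrow> 'k) \<Rightarrow>
      ('k, ('v list \<Rightarrow>\<^sub>0 'k) set set) module"
  where "skew_Clifford_algebra smul x \<mu> \<phi> =
    tensor_algebra smul AQuot
      (Idl\<^bsub>tensor_algebra smul\<^esub> (skew_Clifford_relations smul x \<mu> \<phi>))"


section \<open>Graded skew Clifford algebras\<close>

datatype 'n gen = X 'n | Y 'n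

fun gen_degree :: "'n gen \<Rightarrow> nat" where
  "gen_degree (X i) = 1"
| "gen_degree (Y k) = 2"

definition homogeneous :: "nat \<Rightarrow> ('n gen list \<Rightarrow>\<^sub>0 'k::field) set"
  where "homogeneous d = {p. \<forall>w \<in> Poly_Mapping.keys p. sum_list (map gen_degree w) = d}"

definition degree_two_relations ::
    "'k::field^'n^'n \<Rightarrow> ('n \<Rightarrow> 'k^'n^'n) \<Rightarrow> ('n gen list \<Rightarrow>\<^sub>0 'k) set"
  where "degree_two_relations \<mu> M =
    {monomial [X i, X j] 1 + monomial [X j, X i] (\<mu> $ i $ j)
      - (\<Sum>k\<in>UNIV. monomial [Y k] (M k $ i $ j)) | i j. True}"

text \<open>The algebra on the generators \<open>X i\<close>, \<open>Y k\<close> whose defining relations are the degree-two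
  relations given by \<open>\<mu>\<close>, \<open>M\<close> and the further relations \<open>B\<close>.\<close>

definition gsca_ideal ::
    "'k::field^'n^'n \<Rightarrow> ('n \<Rightarrow> 'k^'n^'n) \<Rightarrow> ('n gen list \<Rightarrow>\<^sub>0 'k) set \<Rightarrow> ('n gen list \<Rightarrow>\<^sub>0 'k) set"
  where "gsca_ideal \<mu> M B = Idl\<^bsub>free_algebra\<^esub> (degree_two_relations \<mu> M \<union> B)"

definition gsca ::
    "'k::field^'n^'n \<Rightarrow> ('n \<Rightarrow> 'k^'n^'n) \<Rightarrow> ('n gen list \<Rightarrow>\<^sub>0 'k) set \<Rightarrow>
      ('k, ('n gen list \<Rightarrow>\<^sub>0 'k) set) module"
  where "gsca \<mu> M B = free_algebra AQuot (gsca_ideal \<mu> M B)"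

definition gsca_component ::
    "'k::field^'n^'n \<Rightarrow> ('n \<Rightarrow> 'k^'n^'n) \<Rightarrow> ('n gen list \<Rightarrow>\<^sub>0 'k) set \<Rightarrow> nat \<Rightarrow>
      ('n gen list \<Rightarrow>\<^sub>0 'k) set set"
  where "gsca_component \<mu> M B d =
    (\<lambda>p. gsca_ideal \<mu> M B +>\<^bsub>free_algebra\<^esub> p) ` homogeneous d"

definition gsca_y ::
    "'k::field^'n^'n \<Rightarrow> ('n \<Rightarrow> 'k^'n^'n) \<Rightarrow> ('n gen list \<Rightarrow>\<^sub>0 'k) set \<Rightarrow> 'n \<Rightarrow>
      ('n gen list \<Rightarrow>\<^sub>0 'k) set"
  where "gsca_y \<mu> M B k = gsca_ideal \<mu> M B +>\<^bsub>free_algebra\<^esub> monomial [Y k] 1"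

text \<open>\<open>gsca \<mu> M B\<close> is a graded skew Clifford algebra associated to \<open>\<mu>\<close> and the matrices \<open>M k\<close>.\<close>

definition is_graded_skew_Clifford ::
    "'k::field^'n^'n \<Rightarrow> ('n \<Rightarrow> 'k^'n^'n) \<Rightarrow> ('n gen list \<Rightarrow>\<^sub>0 'k) set \<Rightarrow> bool"
  where "is_graded_skew_Clifford \<mu> M B \<longleftrightarrow>
    mult_antisymmetric \<mu> \<and> (\<forall>k. mu_symmetric \<mu> (M k)) \<and>
    B \<subseteq> homogeneous 3 \<union> homogeneous 4 \<and>
    (\<exists>rs. length rs = CARD('n) \<and> set rs \<subseteq> gsca_component \<mu> M B 2 \<and>
      normalizing_sequence (gsca \<mu> M B) rs \<and>
      linear_span (gsca \<mu> M B) (set rs) = linear_span (gsca \<mu> M B) (range (gsca_y \<mu> M B)))"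

definition generated_in_degree_one ::
    "'k::field^'n^'n \<Rightarrow> ('n \<Rightarrow> 'k^'n^'n) \<Rightarrow> ('n gen list \<Rightarrow>\<^sub>0 'k) set \<Rightarrow> bool"
  where "generated_in_degree_one \<mu> M B \<longleftrightarrow>
    generated_subalgebra (gsca \<mu> M B) (gsca_component \<mu> M B 1) = carrier (gsca \<mu> M B)"

end

theory Submission
  imports Defs
begin

text \<open>
  Choose basis vectors with \<open>\<phi> (x p) (x q) \<noteq> 0\<close>.  Let \<open>M p\<close> be the Gram matrix of \<open>\<phi>\<close> and, for
  \<open>k \<noteq> p\<close>, let \<open>M k\<close> be the diagonal matrix unit \<open>E\<^sub>k\<^sub>k\<close>; all of these are \<open>\<mu>\<close>-symmetric.  As further
  relations, impose that every \<open>y\<^sub>k\<close> commutes with every generator.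

  The \<open>y\<^sub>k\<close> are then central, so that, listed in any order, they form a normalizing sequence, and
  the algebra is a graded skew Clifford algebra.

  It is generated in degree one because the matrices \<open>M k\<close> are linearly independent.  Indeed
  \<open>E\<^sub>k\<^sub>k\<close> vanishes at position \<open>(p, q)\<close> for every \<open>k \<noteq> p\<close>, even when \<open>p = q\<close>.  So the relation at \<open>(p, q)\<close>
  expresses \<open>y\<^sub>p\<close> through \<open>x\<^sub>p x\<^sub>q\<close> and \<open>x\<^sub>q x\<^sub>p\<close>, after which the relation at \<open>(k, k)\<close> yields \<open>y\<^sub>k\<close>.  The lemma
  \<open>generated_in_degree_one_dual\<close> states this argument for any family of matrices with a dual
  family of coefficients.

  Finally, \<open>x\<^sub>i \<mapsto> x\<^sub>i\<close>, \<open>y\<^sub>p \<mapsto> 2\<close> and \<open>y\<^sub>k \<mapsto> 0\<close> for \<open>k \<noteq> p\<close> turns the relations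
  \<open>x\<^sub>i x\<^sub>j + \<mu>\<^sub>i\<^sub>j x\<^sub>j x\<^sub>i = \<Sum>\<^sub>k (M\<^sub>k)\<^sub>i\<^sub>j y\<^sub>k\<close> into those of the skew Clifford algebra, and scalars commute with
  everything.  This gives a homomorphism onto the skew Clifford algebra, which is generated by the
  \<open>x\<^sub>i\<close> (\<open>skew_Clifford_is_quotient\<close>).  It is constructed by substituting in the free algebra,
  projecting, and factoring through the quotient.
\<close>

section \<open>Quotients of algebras\<close>

text \<open>Scalar multiplication is multiplication by the ring elements \<open>c \<odot> \<one>\<close>.  This is all that is needed
  to make ideals closed under scalars, and it passes to quotients by ideals.\<close>

locale scalar_algebra = ring A for A :: "('k::field, 'a, 'm) module_scheme" (structure) +
  assumes scalar_closed: "c \<odot> \<one> \<in> carrier A"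
    and smult_eq: "a \<in> carrier A \<Longrightarrow> c \<odot> a = (c \<odot> \<one>) \<otimes> a"
begin

lemma smult_closed: "a \<in> carrier A \<Longrightarrow> c \<odot> a \<in> carrier A"
  by (subst smult_eq) (auto intro: scalar_closed)

lemma smult_add:
  "a \<in> carrier A \<Longrightarrow> b \<in> carrier A \<Longrightarrow> c \<odot> (a \<oplus> b) = c \<odot> a \<oplus> c \<odot> b"
  by (metis smult_eq r_distr scalar_closed a_closed)

end

lemma quot_algebra_simps:
  "carrier (A AQuot I) = carrier (A Quot I)"
  "mult (A AQuot I) = mult (A Quot I)"
  "one (A AQuot I) = one (A Quot I)"
  "zero (A AQuot I) = zero (A Quot I)"
  "add (A AQuot I) = add (A Quot I)"
  "smult (A AQuot I) = (\<lambda>c X. \<Union>a\<in>X. I +>\<^bsub>A\<^esub> (c \<odot>\<^bsub>A\<^esub> a))"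
  by (simp_all add: quot_algebra_def ring.defs module.defs)

lemma ring_quot_algebra:
  assumes "ideal I A"
  shows "ring (A AQuot I)"
proof -
  interpret Q: ring "A Quot I" by (rule ideal.quotient_is_ring[OF assms])
  have "\<exists>y\<in>carrier (A Quot I). y \<oplus>\<^bsub>A Quot I\<^esub> x = \<zero>\<^bsub>A Quot I\<^esub>"
    if "x \<in> carrier (A Quot I)" for x
    using that Q.l_neg Q.a_inv_closed by blast
  then show ?thesis
    by (intro ringI abelian_groupI monoidI)
      (simp_all add: quot_algebra_simps Q.a_assoc Q.m_assoc Q.l_distr Q.r_distr, simp add: Q.a_comm)
qed

locale algebra_hom = A?: scalar_algebra A + B?: scalar_algebra B + ring_hom_ring A B h
  for A :: "('k::field, 'a, 'm) module_scheme" (structure)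
    and B :: "('k, 'b, 'p) module_scheme" (structure) and h +
  assumes hom_smult: "a \<in> carrier A \<Longrightarrow> h (c \<odot>\<^bsub>A\<^esub> a) = c \<odot>\<^bsub>B\<^esub> h a"

lemma algebra_homI:
  assumes "scalar_algebra A" "scalar_algebra B" "h \<in> ring_hom A B"
    and "\<And>c a. a \<in> carrier A \<Longrightarrow> h (c \<odot>\<^bsub>A\<^esub> a) = c \<odot>\<^bsub>B\<^esub> h a"
  shows "algebra_hom A B h"
  using assms
  by (simp add: algebra_hom_def algebra_hom_axioms_def ring_hom_ring_def ring_hom_ring_axioms_def
      scalar_algebra_def)

lemma algebra_hom_comp:
  assumes "algebra_hom A B f" and "algebra_hom B C g"
  shows "algebra_hom A C (g \<circ> f)"
proof -
  interpret f: algebra_hom A B f by fact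
  interpret g: algebra_hom B C g by fact
  show ?thesis
    by (rule algebra_homI)
      (auto simp: f.hom_smult g.hom_smult f.A.scalar_algebra_axioms g.B.scalar_algebra_axioms
        intro!: ring_hom_trans[OF f.homh g.homh])
qed

context scalar_algebra
begin

text \<open>Any two representatives of a coset differ by some \<open>i\<close> in the ideal, and \<open>c \<odot> i\<close> lies in the
  ideal again; so all members of the union defining the scalar action coincide.\<close>

lemma smult_coset:
  assumes I: "ideal I A" and a: "a \<in> carrier A"
  shows "c \<odot>\<^bsub>A AQuot I\<^esub> (I +> a) = I +> c \<odot> a"
proof -
  interpret I: ideal I A by fact
  have *: "I +> c \<odot> b = I +> c \<odot> a" if "b \<in> I +> a" for b
  proof -
    obtain i where i: "i \<in> I" "b = i \<oplus> a"
      using \<open>b \<in> I +> a\<close> by (auto simp: a_r_coset_def')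
    have "c \<odot> i \<in> I"
      using i by (subst smult_eq) (auto intro: I.I_l_closed scalar_closed)
    moreover have "c \<odot> b = c \<odot> i \<oplus> c \<odot> a"
      using i a by (simp add: smult_add)
    ultimately have "c \<odot> b \<in> I +> c \<odot> a"
      by (auto simp: a_r_coset_def')
    then show ?thesis
      by (rule a_repr_independence[OF _ smult_closed[OF a] I.a_subgroup, symmetric])
  qed
  have "(\<Union>b\<in>I +> a. I +> c \<odot> b) = (\<Union>b\<in>I +> a. I +> c \<odot> a)"
    by (intro SUP_cong refl *)
  then show ?thesis
    using I.a_rcos_self[OF a] by (auto simp: quot_algebra_simps)
qed

lemma algebra_hom_coset:
  assumes I: "ideal I A"
  shows "algebra_hom A (A AQuot I) ((+>) I)"
proof -
  interpret I: ideal I A by fact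
  have hom: "(+>) I \<in> ring_hom A (A AQuot I)"
    using I.rcos_ring_hom by (simp add: ring_hom_def quot_algebra_simps)
  have coset: "\<exists>a\<in>carrier A. X = I +> a" if "X \<in> carrier (A AQuot I)" for X
    using that by (auto simp: quot_algebra_simps FactRing_simps)
  have "scalar_algebra (A AQuot I)"
  proof (intro scalar_algebra.intro ring_quot_algebra I scalar_algebra_axioms.intro)
    fix c
    have one: "\<one>\<^bsub>A AQuot I\<^esub> = I +> \<one>" by (simp add: quot_algebra_simps FactRing_def)
    show "c \<odot>\<^bsub>A AQuot I\<^esub> \<one>\<^bsub>A AQuot I\<^esub> \<in> carrier (A AQuot I)"
      unfolding one smult_coset[OF I one_closed]
      by (rule ring_hom_closed[OF hom scalar_closed])
    fix X assume "X \<in> carrier (A AQuot I)"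
    then obtain a where a: "a \<in> carrier A" "X = I +> a" using coset by blast
    show "c \<odot>\<^bsub>A AQuot I\<^esub> X = c \<odot>\<^bsub>A AQuot I\<^esub> \<one>\<^bsub>A AQuot I\<^esub> \<otimes>\<^bsub>A AQuot I\<^esub> X"
      unfolding one a(2) smult_coset[OF I one_closed] smult_coset[OF I a(1)]
      by (simp only: ring_hom_mult[OF hom scalar_closed a(1), symmetric] smult_eq[OF a(1), symmetric])
  qed
  then show ?thesis
    using hom
    by (intro algebra_homI) (auto simp: smult_coset[OF I] intro: scalar_algebra_axioms)
qed

lemma coset_image_carrier:
  assumes "ideal I A"
  shows "(+>) I ` carrier A = carrier (A AQuot I)"
  by (auto simp: quot_algebra_simps FactRing_simps)

lemma coset_eq_zero_iff:
  assumes "ideal I A" and "a \<in> carrier A"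
  shows "I +> a = \<zero>\<^bsub>A AQuot I\<^esub> \<longleftrightarrow> a \<in> I"
proof -
  interpret I: ideal I A by fact
  show ?thesis
    using I.a_rcos_const I.a_rcos_self assms by (auto simp: quot_algebra_simps FactRing_def)
qed

end

context algebra_hom
begin

text \<open>On a coset of an ideal inside the kernel, \<open>h\<close> is constant; \<open>the_elem\<close> picks its value.\<close>

lemma image_coset:
  assumes J: "ideal J A" and ker: "\<And>a. a \<in> J \<Longrightarrow> h a = \<zero>\<^bsub>B\<^esub>" and a: "a \<in> carrier A"
  shows "the_elem (h ` (J +>\<^bsub>A\<^esub> a)) = h a"
proof -
  interpret J: ideal J A by fact
  have "h b = h a" if "b \<in> J +>\<^bsub>A\<^esub> a" for b
    using that ker a by (auto simp: a_r_coset_def')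
  then have "h ` (J +>\<^bsub>A\<^esub> a) = {h a}"
    using J.a_rcos_self[OF a] by blast
  then show ?thesis by simp
qed

lemma factor_through_quotient:
  assumes J: "ideal J A" and ker: "\<And>a. a \<in> J \<Longrightarrow> h a = \<zero>\<^bsub>B\<^esub>"
  shows "algebra_hom (A AQuot J) B (\<lambda>X. the_elem (h ` X))"
proof -
  interpret p: algebra_hom A "A AQuot J" "(+>\<^bsub>A\<^esub>) J"
    by (rule A.algebra_hom_coset[OF J])
  have coset: "\<exists>a\<in>carrier A. X = J +>\<^bsub>A\<^esub> a" if "X \<in> carrier (A AQuot J)" for X
    using that A.coset_image_carrier[OF J] by blast
  note val = image_coset[OF J ker]
  show ?thesis
  proof (rule algebra_homI[OF p.B.scalar_algebra_axioms B.scalar_algebra_axioms ring_hom_memI])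
    fix X Y c assume X: "X \<in> carrier (A AQuot J)"
    obtain a where a: "a \<in> carrier A" "X = J +>\<^bsub>A\<^esub> a" using coset[OF X] by blast
    show "the_elem (h ` X) \<in> carrier B" using a by (simp add: val)
    show "the_elem (h ` (c \<odot>\<^bsub>A AQuot J\<^esub> X)) = c \<odot>\<^bsub>B\<^esub> the_elem (h ` X)"
      using a by (simp add: val p.hom_smult[symmetric] hom_smult A.smult_closed)
    assume Y: "Y \<in> carrier (A AQuot J)"
    obtain b where b: "b \<in> carrier A" "Y = J +>\<^bsub>A\<^esub> b" using coset[OF Y] by blast
    show "the_elem (h ` (X \<otimes>\<^bsub>A AQuot J\<^esub> Y)) = the_elem (h ` X) \<otimes>\<^bsub>B\<^esub> the_elem (h ` Y)"
      using a b by (simp add: val p.hom_mult[symmetric] del: p.hom_mult)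
    show "the_elem (h ` (X \<oplus>\<^bsub>A AQuot J\<^esub> Y)) = the_elem (h ` X) \<oplus>\<^bsub>B\<^esub> the_elem (h ` Y)"
      using a b by (simp add: val p.hom_add[symmetric] del: p.hom_add)
  next
    show "the_elem (h ` \<one>\<^bsub>A AQuot J\<^esub>) = \<one>\<^bsub>B\<^esub>"
      by (simp add: val p.hom_one[symmetric] del: p.hom_one)
  qed
qed

text \<open>The first isomorphism theorem for algebras: the ring isomorphism induced on the quotient by the
  kernel respects scalars.\<close>

lemma is_quotient_algebra_of_surj:
  assumes "h ` carrier A = carrier B"
  shows "is_quotient_algebra_of B A"
proof -
  let ?I = "a_kernel A B h"
  have I: "ideal ?I A" by (rule kernel_is_ideal)
  have "(\<lambda>X. the_elem (h ` X)) \<in> ring_iso (A AQuot ?I) B"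
    using FactRing_iso_set[OF assms] by (simp add: ring_iso_def ring_hom_def quot_algebra_simps)
  moreover have "the_elem (h ` (c \<odot>\<^bsub>A AQuot ?I\<^esub> X)) = c \<odot>\<^bsub>B\<^esub> the_elem (h ` X)"
    if X: "X \<in> carrier (A AQuot ?I)" for c X
  proof -
    obtain a where "a \<in> carrier A" "X = ?I +>\<^bsub>A\<^esub> a"
      using X A.coset_image_carrier[OF I] by blast
    then show ?thesis
      using A.smult_closed
      by (simp add: A.smult_coset[OF I] hom_smult)
  qed
  ultimately have "(\<lambda>X. the_elem (h ` X)) \<in> algebra_iso (A AQuot ?I) B"
    by (simp add: algebra_iso_def)
  then show ?thesis
    using I by (auto simp: is_quotient_algebra_of_def)
qed

end

text \<open>The kernel is an ideal, so a homomorphism has to be evaluated only on generating relations.\<close>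

lemma (in algebra_hom) genideal_kernel:
  assumes "S \<subseteq> carrier A" and "\<And>s. s \<in> S \<Longrightarrow> h s = \<zero>\<^bsub>B\<^esub>" and "a \<in> Idl\<^bsub>A\<^esub> S"
  shows "h a = \<zero>\<^bsub>B\<^esub>"
proof -
  have "S \<subseteq> a_kernel A B h"
    using assms unfolding a_kernel_def' by blast
  then have "Idl\<^bsub>A\<^esub> S \<subseteq> a_kernel A B h"
    by (rule A.genideal_minimal[OF kernel_is_ideal])
  then show ?thesis
    using assms(3) unfolding a_kernel_def' by blast
qed

lemma (in algebra_hom) hom_minus:
  "a \<in> carrier A \<Longrightarrow> b \<in> carrier A \<Longrightarrow> h (a \<ominus>\<^bsub>A\<^esub> b) = h a \<ominus>\<^bsub>B\<^esub> h b"
  by (simp add: A.minus_eq B.minus_eq)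

section \<open>Free algebras and substitution\<close>

lemma free_algebra_simps [simp]:
  "carrier free_algebra = UNIV"
  "mult free_algebra = (*)"
  "one free_algebra = 1"
  "zero free_algebra = 0"
  "add free_algebra = (+)"
  "smult free_algebra c p = monomial [] c * p"
  by (simp_all add: free_algebra_def mult_map_scale_conv_mult zero_list_def)

lemma one_eq_monomial: "1 = monomial [] 1"
  by (metis single_one zero_list_def)

lemma monomial_mult: "monomial u a * monomial v b = monomial (u @ v) (a * b)"
  by (simp add: mult_single plus_list_def)

lemma scalar_algebra_free: "scalar_algebra (free_algebra :: ('k::field, 'g list \<Rightarrow>\<^sub>0 'k) module)"
proof -
  have "ring (free_algebra :: ('k::field, 'g list \<Rightarrow>\<^sub>0 'k) module)"
    by (intro ringI abelian_groupI monoidI)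
      (auto simp: algebra_simps intro: exI[of _ "- x" for x])
  then show ?thesis
    by (simp add: scalar_algebra_def scalar_algebra_axioms_def)
qed

interpretation free: scalar_algebra "free_algebra :: ('k::field, 'g list \<Rightarrow>\<^sub>0 'k) module"
  by (rule scalar_algebra_free)

lemma free_minus: "p \<ominus>\<^bsub>free_algebra\<^esub> q = p - q"
proof -
  have "p \<ominus>\<^bsub>free_algebra\<^esub> q + q = p"
    using free.minus_eq[of p q] free.l_neg[of q] by (simp add: add.assoc)
  then show ?thesis by (simp add: algebra_simps)
qed

lemma poly_mapping_additive_induct [case_names zero single add]:
  fixes p :: "'a \<Rightarrow>\<^sub>0 'b::ab_group_add"
  assumes "P 0" "\<And>w c. P (Poly_Mapping.single w c)" "\<And>p q. P p \<Longrightarrow> P q \<Longrightarrow> P (p + q)"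
  shows "P p"
proof (induction p rule: update_induct)
  case const
  then show ?case using assms by simp
next
  case (update f a b)
  have "Poly_Mapping.update a b f = f + Poly_Mapping.single a b"
    using update(1) by (intro poly_mapping_eqI)
      (auto simp: lookup_update lookup_add lookup_single when_def in_keys_iff)
  then show ?case using assms update by simp
qed

text \<open>The free algebra is generated by scalars and letters, because a word is the product of its
  letters.\<close>

lemma free_algebra_induct [case_names scalar letter add mult]:
  fixes p :: "'g list \<Rightarrow>\<^sub>0 'k::field"
  assumes scalar: "\<And>c. P (monomial [] c)" and letter: "\<And>g. P (monomial [g] 1)"
    and add: "\<And>p q. P p \<Longrightarrow> P q \<Longrightarrow> P (p + q)" and mult: "\<And>p q. P p \<Longrightarrow> P q \<Longrightarrow> P (p * q)"
  shows "P p"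
proof (induction p rule: poly_mapping_additive_induct)
  case zero
  show ?case using scalar[of 0] by simp
next
  case (single w c)
  show ?case
  proof (induction w arbitrary: c)
    case (Cons g w)
    then show ?case
      using mult[OF letter[of g], of "monomial w c"] by (simp add: monomial_mult)
  qed (rule scalar)
qed (rule add)

text \<open>The algebra homomorphism between free algebras that sends each letter \<open>g\<close> to \<open>f g\<close>.\<close>

definition substitution ::
    "('g \<Rightarrow> 'h list \<Rightarrow>\<^sub>0 'k::field) \<Rightarrow> ('g list \<Rightarrow>\<^sub>0 'k) \<Rightarrow> ('h list \<Rightarrow>\<^sub>0 'k)"
  where "substitution f p =
    (\<Sum>w\<in>Poly_Mapping.keys p. monomial [] (Poly_Mapping.lookup p w) * prod_list (map f w))"

lemma scalar_monomial_commute: "monomial [] c * p = p * monomial [] (c::'k::field)"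
  by (induction p rule: poly_mapping_additive_induct)
    (simp_all add: monomial_mult algebra_simps)

lemma substitution_monomial:
  "substitution f (monomial w c) = monomial [] c * prod_list (map f w)"
  by (simp add: substitution_def)

lemma substitution_add: "substitution f (p + q) = substitution f p + substitution f q"
  unfolding substitution_def
  by (rule setsum_keys_plus_distrib) (simp_all add: single_add algebra_simps)

text \<open>Multiplicativity is checked on monomials, where it amounts to moving the scalar coefficient of
  the second factor past the image of the first word.\<close>

lemma substitution_mult: "substitution f (p * q) = substitution f p * substitution f q"
proof (induction p rule: poly_mapping_additive_induct)
  case (single u a)
  show ?case
  proof (induction q rule: poly_mapping_additive_induct)
    case (single v b)
    have "substitution f (monomial u a * monomial v b) =
        monomial [] a * (monomial [] b * prod_list (map f u)) * prod_list (map f v)"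
      by (simp add: monomial_mult substitution_monomial mult.assoc[symmetric])
    also have "\<dots> = substitution f (monomial u a) * substitution f (monomial v b)"
      unfolding scalar_monomial_commute[of b] by (simp add: substitution_monomial mult.assoc)
    finally show ?case .
  qed (simp_all add: substitution_add algebra_simps substitution_def[of f 0])
qed (simp_all add: substitution_add algebra_simps substitution_def[of f 0])

lemma algebra_hom_substitution:
  "algebra_hom free_algebra free_algebra (substitution f)"
  by (rule algebra_homI[OF scalar_algebra_free scalar_algebra_free])
    (auto simp: ring_hom_def substitution_add substitution_mult substitution_monomial
      one_eq_monomial[symmetric] substitution_monomial[of f "[]" 1, folded one_eq_monomial])


section \<open>Central elements\<close>

text \<open>Central elements stay central in every quotient, and left and right multiples of a central
  element coincide.\<close>

lemma normalizing_sequence_central: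
  assumes "ring R" and rs: "set rs \<subseteq> carrier R"
    and central: "\<And>r s. r \<in> set rs \<Longrightarrow> s \<in> carrier R \<Longrightarrow> r \<otimes>\<^bsub>R\<^esub> s = s \<otimes>\<^bsub>R\<^esub> r"
  shows "normalizing_sequence R rs"
  unfolding normalizing_sequence_def
proof (intro conjI allI impI rs)
  interpret ring R by fact
  fix i assume "i < length rs"
  then have r: "rs ! i \<in> set rs" by simp
  let ?I = "Idl\<^bsub>R\<^esub> (set (take i rs))"
  interpret I: ideal ?I R
    by (rule genideal_ideal[OF subset_trans[OF set_take_subset rs]])
  interpret p: ring_hom_ring R "R Quot ?I" "(+>\<^bsub>R\<^esub>) ?I"
    by (rule I.rcos_ring_hom_ring)
  have commute: "(?I +>\<^bsub>R\<^esub> rs ! i) \<otimes>\<^bsub>R Quot ?I\<^esub> X = X \<otimes>\<^bsub>R Quot ?I\<^esub> (?I +>\<^bsub>R\<^esub> rs ! i)"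
    if X: "X \<in> carrier (R Quot ?I)" for X
  proof -
    obtain s where "s \<in> carrier R" "X = ?I +>\<^bsub>R\<^esub> s"
      using X unfolding FactRing_def A_RCOSETS_def' by auto
    moreover have "rs ! i \<in> carrier R" using r rs by blast
    ultimately show ?thesis
      by (simp only: p.hom_mult[symmetric] central[OF r])
  qed
  have "?I +>\<^bsub>R\<^esub> rs ! i \<in> carrier (R Quot ?I)"
    using r rs by (intro p.hom_closed) blast
  moreover have "(?I +>\<^bsub>R\<^esub> rs ! i) <#\<^bsub>R Quot ?I\<^esub> carrier (R Quot ?I) =
      carrier (R Quot ?I) #>\<^bsub>R Quot ?I\<^esub> (?I +>\<^bsub>R\<^esub> rs ! i)"
    unfolding l_coset_def r_coset_def by (intro SUP_cong refl) (simp only: commute)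
  ultimately show "normal_element (R Quot ?I) (?I +>\<^bsub>R\<^esub> rs ! i)"
    unfolding normal_element_def by (rule conjI)
qed

section \<open>Graded skew Clifford algebras with central degree-two generators\<close>

definition y_commutators :: "('n gen list \<Rightarrow>\<^sub>0 'k::field) set"
  where "y_commutators = {monomial [Y k, g] 1 - monomial [g, Y k] 1 | k g. True}"

lemma ideal_gsca_ideal: "ideal (gsca_ideal \<mu> M B) free_algebra"
  unfolding gsca_ideal_def by (rule free.genideal_ideal) simp

lemma gsca_hom: "algebra_hom free_algebra (gsca \<mu> M B) ((+>\<^bsub>free_algebra\<^esub>) (gsca_ideal \<mu> M B))"
  unfolding gsca_def by (rule free.algebra_hom_coset[OF ideal_gsca_ideal])

lemma coset_eq_of_relation:
  assumes "p - q \<in> S"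
  shows "Idl\<^bsub>free_algebra\<^esub> S +>\<^bsub>free_algebra\<^esub> p = Idl\<^bsub>free_algebra\<^esub> S +>\<^bsub>free_algebra\<^esub> q"
proof -
  have "p - q \<in> Idl\<^bsub>free_algebra\<^esub> S"
    using free.genideal_self[of S] assms by auto
  then show ?thesis
    using free.quotient_eq_iff_same_a_r_cos[OF free.genideal_ideal[of S], of p q]
    by (simp add: free_minus)
qed

lemma gsca_relation:
  assumes "p - q \<in> degree_two_relations \<mu> M \<union> B"
  shows "gsca_ideal \<mu> M B +>\<^bsub>free_algebra\<^esub> p = gsca_ideal \<mu> M B +>\<^bsub>free_algebra\<^esub> q"
  unfolding gsca_ideal_def by (rule coset_eq_of_relation[OF assms])

lemma carrier_gsca: "carrier (gsca \<mu> M B) = range ((+>\<^bsub>free_algebra\<^esub>) (gsca_ideal \<mu> M B))"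
  unfolding gsca_def
  using free.coset_image_carrier[OF ideal_gsca_ideal, of \<mu> M B, symmetric]
  by (simp only: free_algebra_simps(1))

text \<open>The elements that commute with \<open>y\<^sub>k\<close> form a subalgebra, and by the commutator relations it
  contains all generators.\<close>

lemma gsca_y_central:
  assumes "s \<in> carrier (gsca \<mu> M y_commutators)"
  shows "gsca_y \<mu> M y_commutators k \<otimes>\<^bsub>gsca \<mu> M y_commutators\<^esub> s =
    s \<otimes>\<^bsub>gsca \<mu> M y_commutators\<^esub> gsca_y \<mu> M y_commutators k"
proof -
  let ?G = "gsca \<mu> M y_commutators" and ?J = "gsca_ideal \<mu> M y_commutators"
  let ?y = "gsca_y \<mu> M y_commutators k"
  interpret p: algebra_hom free_algebra ?G "(+>\<^bsub>free_algebra\<^esub>) ?J" by (rule gsca_hom)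
  have y: "?y = ?J +>\<^bsub>free_algebra\<^esub> monomial [Y k] 1" by (simp add: gsca_y_def)
  then have y_carrier: "?y \<in> carrier ?G" by simp
  have "?y \<otimes>\<^bsub>?G\<^esub> (?J +>\<^bsub>free_algebra\<^esub> q) = (?J +>\<^bsub>free_algebra\<^esub> q) \<otimes>\<^bsub>?G\<^esub> ?y" for q
  proof (induction q rule: free_algebra_induct)
    case (scalar c)
    show ?case
      using p.hom_mult[of "monomial [Y k] 1" "monomial [] c"]
        p.hom_mult[of "monomial [] c" "monomial [Y k] 1"]
      by (simp add: y scalar_monomial_commute)
  next
    case (letter g)
    have "?J +>\<^bsub>free_algebra\<^esub> monomial [Y k, g] 1 = ?J +>\<^bsub>free_algebra\<^esub> monomial [g, Y k] 1"
      by (rule gsca_relation) (auto simp: y_commutators_def)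
    then show ?case
      using p.hom_mult[of "monomial [Y k] 1" "monomial [g] 1"]
        p.hom_mult[of "monomial [g] 1" "monomial [Y k] 1"]
      by (simp add: y monomial_mult)
  next
    case (add q r)
    have "?J +>\<^bsub>free_algebra\<^esub> (q + r) =
        (?J +>\<^bsub>free_algebra\<^esub> q) \<oplus>\<^bsub>?G\<^esub> (?J +>\<^bsub>free_algebra\<^esub> r)"
      using p.hom_add[of q r] by simp
    then show ?case
      using add y_carrier p.hom_closed[of q] p.hom_closed[of r] by (simp add: p.B.l_distr p.B.r_distr)
  next
    case (mult q r)
    have "?J +>\<^bsub>free_algebra\<^esub> (q * r) =
        (?J +>\<^bsub>free_algebra\<^esub> q) \<otimes>\<^bsub>?G\<^esub> (?J +>\<^bsub>free_algebra\<^esub> r)"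
      using p.hom_mult[of q r] by simp
    moreover have "?y \<otimes>\<^bsub>?G\<^esub> (a \<otimes>\<^bsub>?G\<^esub> b) = (a \<otimes>\<^bsub>?G\<^esub> b) \<otimes>\<^bsub>?G\<^esub> ?y"
      if "a \<in> carrier ?G" "b \<in> carrier ?G"
        "?y \<otimes>\<^bsub>?G\<^esub> a = a \<otimes>\<^bsub>?G\<^esub> ?y" "?y \<otimes>\<^bsub>?G\<^esub> b = b \<otimes>\<^bsub>?G\<^esub> ?y" for a b
      using that y_carrier by (metis p.B.m_assoc)
    ultimately show ?case
      using mult p.hom_closed[of q] p.hom_closed[of r] by simp
  qed
  then show ?thesis
    using assms unfolding carrier_gsca by blast
qed

lemma homogeneous_monomial: "sum_list (map gen_degree w) = d \<Longrightarrow> monomial w c \<in> homogeneous d"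
  by (simp add: homogeneous_def)

lemma homogeneous_diff:
  assumes "p \<in> homogeneous d" "q \<in> homogeneous d"
  shows "p - q \<in> homogeneous d"
  using assms by (auto simp: homogeneous_def in_keys_iff lookup_minus)

text \<open>A commutator of \<open>y\<^sub>k\<close> has degree 3 with some \<open>x\<^sub>i\<close> and degree 4 with some \<open>y\<^sub>l\<close>.\<close>

lemma y_commutators_homogeneous: "y_commutators \<subseteq> homogeneous 3 \<union> homogeneous 4"
proof
  fix p :: "'n gen list \<Rightarrow>\<^sub>0 'k::field"
  assume "p \<in> y_commutators"
  then obtain k g where p: "p = monomial [Y k, g] 1 - monomial [g, Y k] 1"
    by (auto simp: y_commutators_def)
  have "p \<in> homogeneous (2 + gen_degree g)"
    unfolding p by (intro homogeneous_diff homogeneous_monomial) simp_all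
  then show "p \<in> homogeneous 3 \<union> homogeneous 4"
    by (cases g) (simp_all add: numeral_eq_Suc)
qed

lemma is_graded_skew_Clifford_y_commutators:
  fixes \<mu> :: "'k::field^'n::finite^'n" and M :: "'n \<Rightarrow> 'k^'n^'n"
  assumes "mult_antisymmetric \<mu>" and "\<And>k. mu_symmetric \<mu> (M k)"
  shows "is_graded_skew_Clifford \<mu> M y_commutators"
proof -
  let ?G = "gsca \<mu> M y_commutators" and ?y = "gsca_y \<mu> M y_commutators"
  interpret p: algebra_hom free_algebra ?G "(+>\<^bsub>free_algebra\<^esub>) (gsca_ideal \<mu> M y_commutators)"
    by (rule gsca_hom)
  obtain ks :: "'n list" where ks: "set ks = UNIV" "distinct ks"
    using finite_distinct_list[OF finite, of UNIV] by blast
  let ?rs = "map ?y ks"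
  have "length ?rs = CARD('n)"
    using ks distinct_card by fastforce
  moreover have "set ?rs \<subseteq> gsca_component \<mu> M y_commutators 2"
    by (auto simp: gsca_component_def gsca_y_def intro!: imageI homogeneous_monomial)
  moreover have "normalizing_sequence ?G ?rs"
  proof (rule normalizing_sequence_central[OF p.B.ring_axioms])
    show "set ?rs \<subseteq> carrier ?G"
      by (auto simp: gsca_y_def carrier_gsca)
  qed (auto simp only: set_map gsca_y_central)
  moreover have "set ?rs = range ?y" using ks by simp
  ultimately show ?thesis
    using assms y_commutators_homogeneous unfolding is_graded_skew_Clifford_def by metis
qed

section \<open>Generation in degree one\<close>

lemma monomial_sum: "monomial w (sum c A) = (\<Sum>a\<in>A. monomial w (c a))"
  by (induction A rule: infinite_finite_induct) (simp_all add: single_add)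

text \<open>Coefficients dual to the matrices \<open>M l\<close> exist exactly when these are linearly independent.
  Combining the degree-two relations with the coefficients \<open>c k\<close> leaves \<open>y\<^sub>k\<close> alone on the right,
  and a combination of products \<open>x\<^sub>i x\<^sub>j\<close> on the left.\<close>

lemma generated_in_degree_one_dual:
  fixes \<mu> :: "'k::field^'n::finite^'n" and M :: "'n \<Rightarrow> 'k^'n^'n"
  assumes dual: "\<And>k l. (\<Sum>i\<in>UNIV. \<Sum>j\<in>UNIV. c k i j * M l $ i $ j) = (if l = k then 1 else 0)"
  shows "generated_in_degree_one \<mu> M B"
proof -
  let ?G = "gsca \<mu> M B" and ?J = "gsca_ideal \<mu> M B"
  interpret p: algebra_hom free_algebra ?G "(+>\<^bsub>free_algebra\<^esub>) ?J" by (rule gsca_hom)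
  have "carrier ?G \<subseteq> W"
    if W: "subring W ?G" "\<And>c w. w \<in> W \<Longrightarrow> c \<odot>\<^bsub>?G\<^esub> w \<in> W" "gsca_component \<mu> M B 1 \<subseteq> W" for W
  proof -
    \<comment> \<open>The preimage of \<open>W\<close> in the free algebra; it is everything once it contains all letters.\<close>
    define S where "S = {q. ?J +>\<^bsub>free_algebra\<^esub> q \<in> W}"
    have S_add: "q + r \<in> S" if "q \<in> S" "r \<in> S" for q r
      using that p.hom_add[of q r] subringE(7)[OF W(1)] by (simp add: S_def)
    have S_mult: "q * r \<in> S" if "q \<in> S" "r \<in> S" for q r
      using that p.hom_mult[of q r] subringE(6)[OF W(1)] by (simp add: S_def)
    have S_scalar: "monomial [] c \<in> S" for c
      using p.hom_smult[of 1 c] p.hom_one W(2)[OF subringE(3)[OF W(1)], of c] by (simp add: S_def)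
    have S_sum: "(\<Sum>a\<in>A. f a) \<in> S" if "\<And>a. a \<in> A \<Longrightarrow> f a \<in> S" for A :: "'n set" and f
      using that S_scalar[of 0]
      by (induction A rule: infinite_finite_induct) (auto intro: S_add)
    have S_x: "monomial [X i] 1 \<in> S" for i
      unfolding S_def
      by (auto intro!: subsetD[OF W(3)] imageI homogeneous_monomial simp: gsca_component_def)
    have S_relation: "(\<Sum>l\<in>UNIV. monomial [Y l] (M l $ i $ j)) \<in> S" for i j
    proof -
      have "?J +>\<^bsub>free_algebra\<^esub> (monomial [X i, X j] 1 + monomial [X j, X i] (\<mu> $ i $ j)) =
          ?J +>\<^bsub>free_algebra\<^esub> (\<Sum>l\<in>UNIV. monomial [Y l] (M l $ i $ j))"
        by (rule gsca_relation) (auto simp: degree_two_relations_def)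
      moreover have "monomial [X i] 1 * monomial [X j] 1 +
          monomial [] (\<mu> $ i $ j) * (monomial [X j] 1 * monomial [X i] 1) \<in> S"
        by (intro S_add S_mult S_x S_scalar)
      ultimately show ?thesis by (simp add: S_def monomial_mult)
    qed
    have S_y: "monomial [Y k] 1 \<in> S" for k
    proof -
      have "monomial [Y k] 1 = (\<Sum>l\<in>UNIV. monomial [Y l] (if l = k then 1 else (0::'k)))"
        by (subst sum.remove[of _ k]) auto
      also have "\<dots> = (\<Sum>l\<in>UNIV. \<Sum>i\<in>UNIV. \<Sum>j\<in>UNIV. monomial [Y l] (c k i j * M l $ i $ j))"
        by (simp only: dual[symmetric] monomial_sum)
      also have "\<dots> = (\<Sum>i\<in>UNIV. \<Sum>j\<in>UNIV. \<Sum>l\<in>UNIV. monomial [Y l] (c k i j * M l $ i $ j))"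
        by (subst sum.swap) (intro sum.cong sum.swap refl)
      also have "\<dots> = (\<Sum>i\<in>UNIV. \<Sum>j\<in>UNIV.
          monomial [] (c k i j) * (\<Sum>l\<in>UNIV. monomial [Y l] (M l $ i $ j)))"
        by (simp add: sum_distrib_left monomial_mult)
      also have "\<dots> \<in> S"
        by (intro S_sum S_mult S_scalar S_relation)
      finally show ?thesis .
    qed
    have "q \<in> S" for q
    proof (induction q rule: free_algebra_induct)
      case (letter g)
      show ?case by (cases g) (simp_all add: S_x S_y)
    qed (auto intro: S_add S_mult S_scalar)
    then show ?thesis
      unfolding carrier_gsca S_def by blast
  qed
  moreover have "gsca_component \<mu> M B 1 \<subseteq> carrier ?G"
    unfolding carrier_gsca gsca_component_def by blast
  ultimately show ?thesis
    unfolding generated_in_degree_one_def generated_subalgebra_def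
    using p.B.carrier_is_subring p.B.smult_closed by (intro equalityI Inter_greatest Inter_lower) auto
qed

section \<open>The skew Clifford algebra as a quotient\<close>

text \<open>Sending \<open>y\<^sub>p\<close> to 2 and the other \<open>y\<^sub>k\<close> to zero leaves only the Gram matrix on the right-hand side of
  the degree-two relations, which become the defining relations of the skew Clifford algebra; the
  commutators are sent to zero because all \<open>y\<^sub>k\<close> become scalars.\<close>

lemma skew_Clifford_is_quotient:
  fixes smul :: "'k::field \<Rightarrow> 'v::ab_group_add \<Rightarrow> 'v" and x :: "'n::finite \<Rightarrow> 'v"
    and \<mu> :: "'k^'n^'n" and M :: "'n \<Rightarrow> 'k^'n^'n"
  assumes vs: "vector_space smul" and basis: "ordered_basis smul x"
    and gram: "\<And>i j. M p $ i $ j = \<phi> (x i) (x j)"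
  shows "is_quotient_algebra_of (skew_Clifford_algebra smul x \<mu> \<phi>) (gsca \<mu> M y_commutators)"
proof -
  let ?T = "tensor_algebra smul" and ?C = "skew_Clifford_algebra smul x \<mu> \<phi>"
  let ?L = "linearity_relations smul" and ?R = "skew_Clifford_relations smul x \<mu> \<phi>"
  have L: "ideal (Idl\<^bsub>free_algebra\<^esub> ?L) free_algebra"
    by (rule free.genideal_ideal) simp
  define t where "t = (+>\<^bsub>free_algebra\<^esub>) (Idl\<^bsub>free_algebra\<^esub> ?L)"
  interpret t: algebra_hom free_algebra ?T t
    unfolding t_def tensor_algebra_def by (rule free.algebra_hom_coset[OF L])
  have incl: "tensor_incl smul v = t (monomial [v] 1)" for v
    by (simp add: tensor_incl_def t_def)
  have R_carrier: "?R \<subseteq> carrier ?T"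
    by (auto simp: skew_Clifford_relations_def Let_def incl t.B.minus_eq t.B.smult_closed)
  then have R: "ideal (Idl\<^bsub>?T\<^esub> ?R) ?T" by (rule t.B.genideal_ideal)
  define c where "c = (+>\<^bsub>?T\<^esub>) (Idl\<^bsub>?T\<^esub> ?R)"
  interpret c: algebra_hom ?T ?C c
    unfolding c_def skew_Clifford_algebra_def by (rule t.B.algebra_hom_coset[OF R])
  interpret ct: algebra_hom free_algebra ?C "c \<circ> t"
    by (rule algebra_hom_comp[OF t.algebra_hom_axioms c.algebra_hom_axioms])
  \<comment> \<open>The value 2 at \<open>Y p\<close> matches the factor in the right-hand side \<open>2 \<phi>(x\<^sub>i, x\<^sub>j)\<close>.\<close>
  define f :: "'n gen \<Rightarrow> 'v list \<Rightarrow>\<^sub>0 'k"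
    where "f g = (case g of X i \<Rightarrow> monomial [x i] 1 | Y k \<Rightarrow> monomial [] (if k = p then 2 else 0))" for g
  define h where "h = (c \<circ> t) \<circ> substitution f"
  interpret h: algebra_hom free_algebra ?C h
    unfolding h_def by (rule algebra_hom_comp[OF algebra_hom_substitution ct.algebra_hom_axioms])
  interpret s: algebra_hom free_algebra free_algebra "substitution f"
    by (rule algebra_hom_substitution)

  have s_diff: "substitution f (q - r) = substitution f q - substitution f r" for q r
    using s.hom_minus[of q r] by (simp add: free_minus)
  have s_sum: "substitution f (\<Sum>k\<in>A. q k) = (\<Sum>k\<in>A. substitution f (q k))" for q and A :: "'n set"
    by (induction A rule: infinite_finite_induct)
      (simp_all add: substitution_add substitution_def[of f 0])
  have kill2: "h r = \<zero>\<^bsub>?C\<^esub>" if r: "r \<in> degree_two_relations \<mu> M" for r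
  proof -
    obtain i j where r: "r = monomial [X i, X j] 1 + monomial [X j, X i] (\<mu> $ i $ j)
        - (\<Sum>k\<in>UNIV. monomial [Y k] (M k $ i $ j))"
      using r by (auto simp: degree_two_relations_def)
    have "(\<Sum>k\<in>UNIV. substitution f (monomial [Y k] (M k $ i $ j))) =
        monomial [] (2 * \<phi> (x i) (x j))"
      by (subst sum.remove[of _ p])
        (auto simp: substitution_monomial f_def monomial_mult gram mult.commute)
    then have "substitution f r = (monomial [x i] 1 * monomial [x j] 1
        \<oplus>\<^bsub>free_algebra\<^esub> (\<mu> $ i $ j) \<odot>\<^bsub>free_algebra\<^esub> (monomial [x j] 1 * monomial [x i] 1))
        \<ominus>\<^bsub>free_algebra\<^esub> (2 * \<phi> (x i) (x j)) \<odot>\<^bsub>free_algebra\<^esub> 1"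
      by (simp add: r s_diff s_sum substitution_add substitution_monomial f_def monomial_mult
          free_minus one_eq_monomial)
    moreover have "t (q * r) = t q \<otimes>\<^bsub>?T\<^esub> t r" for q r
      using t.hom_mult[of q r] by simp
    moreover have "t 1 = \<one>\<^bsub>?T\<^esub>"
      using t.hom_one by simp
    ultimately have "t (substitution f r) \<in> ?R"
      by (auto simp: skew_Clifford_relations_def Let_def incl t.hom_minus t.hom_smult
          simp del: free_algebra_simps(2-))
    then have "t (substitution f r) \<in> Idl\<^bsub>?T\<^esub> ?R"
      using t.B.genideal_self[OF R_carrier] by blast
    then show ?thesis
      unfolding h_def c_def skew_Clifford_algebra_def using t.B.coset_eq_zero_iff[OF R] by simp
  qed
  have killB: "h r = \<zero>\<^bsub>?C\<^esub>" if r: "r \<in> y_commutators" for r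
  proof -
    obtain k g where r: "r = monomial [Y k, g] 1 - monomial [g, Y k] 1"
      using r by (auto simp: y_commutators_def)
    have "f (Y k) * f g = f g * f (Y k)"
      by (simp add: f_def scalar_monomial_commute)
    then have "substitution f r = 0"
      by (simp add: r s_diff substitution_monomial one_eq_monomial[symmetric])
    then show ?thesis
      using ct.hom_zero by (simp add: h_def)
  qed
  have kill: "h r = \<zero>\<^bsub>?C\<^esub>" if "r \<in> gsca_ideal \<mu> M y_commutators" for r
    using h.genideal_kernel[of "degree_two_relations \<mu> M \<union> y_commutators" r] kill2 killB that
    by (auto simp: gsca_ideal_def)

  \<comment> \<open>Surjectivity: the preimage of \<open>range h\<close> under \<open>v \<mapsto> c (t [v])\<close> is a subspace containing the basis.\<close>
  have L_add: "t (monomial [v + w] 1) = t (monomial [v] 1) \<oplus>\<^bsub>?T\<^esub> t (monomial [w] 1)" for v w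
  proof -
    have "t (monomial [v + w] 1) = t (monomial [v] 1 + monomial [w] 1)"
      unfolding t_def
      by (rule coset_eq_of_relation) (auto simp: linearity_relations_def diff_diff_eq[symmetric])
    then show ?thesis
      using t.hom_add[of "monomial [v] 1" "monomial [w] 1"] by simp
  qed
  have L_smul: "t (monomial [smul a v] 1) = a \<odot>\<^bsub>?T\<^esub> t (monomial [v] 1)" for a v
  proof -
    have "t (monomial [smul a v] 1) = t (monomial [v] a)"
      unfolding t_def by (rule coset_eq_of_relation) (auto simp: linearity_relations_def)
    then show ?thesis
      using t.hom_smult[of "monomial [v] 1" a] by (simp add: monomial_mult)
  qed
  have range_add: "a \<oplus>\<^bsub>?C\<^esub> b \<in> range h" if ab: "a \<in> range h" "b \<in> range h" for a b
  proof -
    obtain q r where "a = h q" "b = h r" using ab by blast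
    then have "a \<oplus>\<^bsub>?C\<^esub> b = h (q + r)" using h.hom_add[of q r] by simp
    then show ?thesis by simp
  qed
  have range_mult: "a \<otimes>\<^bsub>?C\<^esub> b \<in> range h" if ab: "a \<in> range h" "b \<in> range h" for a b
  proof -
    obtain q r where "a = h q" "b = h r" using ab by blast
    then have "a \<otimes>\<^bsub>?C\<^esub> b = h (q * r)" using h.hom_mult[of q r] by simp
    then show ?thesis by simp
  qed
  have range_smult: "k \<odot>\<^bsub>?C\<^esub> a \<in> range h" if a: "a \<in> range h" for k a
  proof -
    obtain q where "a = h q" using a by blast
    then have "k \<odot>\<^bsub>?C\<^esub> a = h (monomial [] k * q)" using h.hom_smult[of q k] by simp
    then show ?thesis by simp
  qed
  have range_letter: "c (t (monomial [v] 1)) \<in> range h" for v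
  proof -
    interpret vector_space smul by fact
    let ?V = "{v. c (t (monomial [v] 1)) \<in> range h}"
    have smul: "smul a v \<in> ?V" if "v \<in> ?V" for a v
      using that range_smult[of "c (t (monomial [v] 1))" a]
      by (simp add: L_smul c.hom_smult del: free_algebra_simps(2-))
    have x: "x i \<in> ?V" for i
    proof -
      have "c (t (monomial [x i] 1)) = h (monomial [X i] 1)"
        by (simp add: h_def substitution_monomial f_def monomial_mult)
      then show ?thesis by simp
    qed
    have "0 \<in> ?V"
      using smul[OF x, of 0 undefined] by simp
    then have "subspace ?V"
      by (intro subspaceI smul) (auto simp: L_add intro: range_add)
    moreover have "range x \<subseteq> ?V" using x by blast
    ultimately have "span (range x) \<subseteq> ?V" by (rule span_minimal[rotated])
    then show ?thesis using basis unfolding ordered_basis_def by auto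
  qed
  have "c (t q) \<in> range h" for q
  proof (induction q rule: free_algebra_induct)
    case (scalar k)
    have "c (t (monomial [] k)) = h (monomial [] k)"
      by (simp add: h_def substitution_monomial monomial_mult one_eq_monomial)
    then show ?case by simp
  next
    case (add q r)
    then show ?case using range_add ct.hom_add[of q r] by simp
  next
    case (mult q r)
    then show ?case using range_mult ct.hom_mult[of q r] by simp
  qed (rule range_letter)
  moreover have "carrier ?C = range (c \<circ> t)"
  proof -
    have "carrier ?T = range t"
      unfolding t_def tensor_algebra_def using free.coset_image_carrier[OF L] by simp
    moreover have "carrier ?C = c ` carrier ?T"
      unfolding c_def skew_Clifford_algebra_def by (rule t.B.coset_image_carrier[OF R, symmetric])
    ultimately show ?thesis by (simp add: image_comp)
  qed
  ultimately have surj: "carrier ?C \<subseteq> range h" by auto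
  define h' where "h' = (\<lambda>X. the_elem (h ` X))"
  interpret h': algebra_hom "gsca \<mu> M y_commutators" ?C h'
    unfolding h'_def gsca_def by (rule h.factor_through_quotient[OF ideal_gsca_ideal kill])
  have "h' (gsca_ideal \<mu> M y_commutators +>\<^bsub>free_algebra\<^esub> q) = h q" for q
    unfolding h'_def by (rule h.image_coset[OF ideal_gsca_ideal kill]) simp_all
  then have "range h \<subseteq> h' ` carrier (gsca \<mu> M y_commutators)"
    unfolding carrier_gsca by (auto simp: image_iff)
  then show ?thesis
    using surj by (intro h'.is_quotient_algebra_of_surj) auto
qed

section \<open>The choice of the matrices\<close>

text \<open>Otherwise each \<open>\<phi> (x i)\<close> vanishes on the span of the basis, hence each \<open>\<lambda>v. \<phi> v w\<close> vanishes on the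
  basis, and then on its span.\<close>

lemma bilinear_form_nonzero_on_basis:
  assumes "vector_space smul" and "ordered_basis smul x" and "bilinear_form smul \<phi>"
    and "\<phi> \<noteq> (\<lambda>v w. 0)"
  obtains p q where "\<phi> (x p) (x q) \<noteq> 0"
proof (rule ccontr)
  assume "\<not> thesis"
  then have zero: "\<phi> (x i) (x j) = 0" for i j using that by blast
  interpret vector_space smul by fact
  have span: "v \<in> span (range x)" for v using assms(2) by (auto simp: ordered_basis_def)
  have l: "Vector_Spaces.linear smul (*) (\<phi> v)" "Vector_Spaces.linear smul (*) (\<lambda>v. \<phi> v w)" for v w
    using assms(3) by (auto simp: bilinear_form_def)
  have "\<phi> (x i) w = 0" for i w
  proof -
    interpret l: Vector_Spaces.linear smul "(*)" "\<phi> (x i)" by (rule l)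
    show ?thesis by (rule l.eq_0_on_span[OF _ span]) (auto simp: zero)
  qed
  then have "\<phi> v w = 0" for v w
  proof -
    interpret l: Vector_Spaces.linear smul "(*)" "\<lambda>v. \<phi> v w" by (rule l)
    assume *: "\<And>i w. \<phi> (x i) w = 0"
    show ?thesis by (rule l.eq_0_on_span[OF _ span]) (auto simp: *)
  qed
  then show False using assms(4) by blast
qed

theorem theorem5p4:
  fixes smul :: "'k::field \<Rightarrow> 'v::ab_group_add \<Rightarrow> 'v"
    and x :: "'n::finite \<Rightarrow> 'v"
    and \<mu> :: "'k^'n^'n"
    and \<phi> :: "'v \<Rightarrow> 'v \<Rightarrow> 'k"
  assumes "CHAR('k) \<noteq> 2"
    and "vector_space smul"
    and "ordered_basis smul x"
    and "mult_antisymmetric \<mu>"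
    and "bilinear_form smul \<phi>"
    and "mu_symmetric_form \<mu> x \<phi>"
    and "\<phi> \<noteq> (\<lambda>v w. 0)"
  shows "\<exists>M B. is_graded_skew_Clifford \<mu> M B \<and>
    generated_in_degree_one \<mu> M B \<and>
    is_quotient_algebra_of (skew_Clifford_algebra smul x \<mu> \<phi>) (gsca \<mu> M B)"
proof -
  obtain p q where pq: "\<phi> (x p) (x q) \<noteq> 0"
    using bilinear_form_nonzero_on_basis[OF assms(2,3,5,7)] by blast
  define M :: "'n \<Rightarrow> 'k^'n^'n" where "M k =
    (if k = p then \<chi> i j. \<phi> (x i) (x j) else \<chi> i j. if i = k \<and> j = k then 1 else 0)" for k
  have "mu_symmetric \<mu> (M k)" for k
    unfolding mu_symmetric_def
  proof (intro allI)
    fix i j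
    have "\<phi> (x i) (x j) = \<mu> $ i $ j * \<phi> (x j) (x i)" and "\<mu> $ k $ k = 1"
      using assms(4,6) unfolding mu_symmetric_form_def mult_antisymmetric_def by blast+
    then show "M k $ i $ j = \<mu> $ i $ j * M k $ j $ i"
      by (auto simp: M_def)
  qed
  then have "is_graded_skew_Clifford \<mu> M y_commutators"
    using assms(4) by (intro is_graded_skew_Clifford_y_commutators)
  moreover have "generated_in_degree_one \<mu> M y_commutators"
  proof -
    \<comment> \<open>Since \<open>M l\<close> vanishes at \<open>(p, q)\<close> for \<open>l \<noteq> p\<close>, the entry there divided by \<open>\<phi> (x p) (x q)\<close> isolates
      \<open>y\<^sub>p\<close>.  For \<open>k \<noteq> p\<close>, the entry at \<open>(k, k)\<close> involves only \<open>y\<^sub>k\<close> and \<open>y\<^sub>p\<close>, with coefficients 1 and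
      \<open>\<phi> (x k) (x k)\<close>; the second summand cancels the latter.\<close>
    define c where "c k i j =
      (if i = k \<and> j = k then if k = p then 0 else 1 else 0) +
      (if i = p \<and> j = q then (if k = p then 1 else - \<phi> (x k) (x k)) / \<phi> (x p) (x q) else 0)" for k i j
    have unit: "(\<Sum>i\<in>UNIV. \<Sum>j\<in>UNIV. (if i = a \<and> j = b then e else 0) * N $ i $ j) = e * N $ a $ b"
      for a b :: 'n and e and N :: "'k^'n^'n"
    proof -
      have "(\<Sum>j\<in>UNIV. (if i = a \<and> j = b then e else 0) * N $ i $ j) =
          (if i = a then e * N $ a $ b else 0)" for i
        by (subst sum.remove[of _ b]) auto
      then show ?thesis by simp
    qed
    have "(\<Sum>i\<in>UNIV. \<Sum>j\<in>UNIV. c k i j * M l $ i $ j) = (if l = k then 1 else 0)" for k l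
      unfolding c_def distrib_right sum.distrib unit using pq by (auto simp: M_def)
    then show ?thesis by (rule generated_in_degree_one_dual)
  qed
  moreover have "is_quotient_algebra_of (skew_Clifford_algebra smul x \<mu> \<phi>) (gsca \<mu> M y_commutators)"
    by (rule skew_Clifford_is_quotient[OF assms(2,3), of M p]) (simp add: M_def)
  ultimately show ?thesis by blast
qed

end
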